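(* Let $1\leq p\leq q\leq\infty$, and let $\alpha$ be a countable ordinal. Then for every Tychonoff space $X$, the function spaces $C_p(X)$ and $B_\alpha(X)$ have the properties $V_{(p,q)}$, $EV_{(p,q)}$, $sV_{(p,q)}$, $sEV_{(p,q)}$, $wsV_{(p,q)}$ and $wsEV_{(p,q)}$.
   Context: $\mathbb{F}$ denotes $\mathbb{R}$ or $\mathbb{C}$. A Tychonoff space is a completely regular $T_1$ space. $C_p(X)$ is the space of continuous $\mathbb{F}$-valued functions on $X$ with the topology of pointwise convergence. Put $B_0(X):=C_p(X)$ and, for a nonzero countable ordinal $\alpha$, let $B_\alpha(X)$ be the space of all functions $f:X\to\mathbb{F}$ that are pointwise limits of sequences from $\bigcup_{\beta<\alpha}B_\beta(X)$, with the topology of pointwise convergence inherited from $\mathbb{F}^X$. For a locally convex space $E$ with topological dual $E'$, $E'_\beta$ is $E'$ with the strong topology $\beta(E',E)$. A subset $B\subseteq E'$ is equicontinuous if $B\subseteq U^\circ=\{\chi\in E':|\langle\chi,x\rangle|\le1\ \forall x\in U\}$ for some neighborhood $U$ of zero in $E$. A sequence $\{x_n\}_{n\in\omega}$ in $E$ is weakly $p$-summable if $(\langle\chi,x_n\rangle)_n\in\ell_p$ (or $\in c_0$ if $p=\infty$) for every $\chi\in E'$. A non-empty $B\subseteq E'$ is a $(p,q)$-$(V)$ set if $\big(\sup_{\chi\in B}|\langle\chi,x_n\rangle|\big)_n\in\ell_q$ (or $\in c_0$ if $q=\infty$) for every weakly $p$-summable sequence $\{x_n\}$ in $E$; it is a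 $(p,q)$-$(EV)$ set if in addition it is equicontinuous. $E$ has the property $V_{(p,q)}$ (resp. $sV_{(p,q)}$, $wsV_{(p,q)}$) if every $(p,q)$-$(V)$ set is relatively weakly compact (resp. relatively weakly sequentially compact, weakly sequentially precompact) in $E'_\beta$; the properties $EV_{(p,q)}$, $sEV_{(p,q)}$, $wsEV_{(p,q)}$ are defined in the same way with $(p,q)$-$(EV)$ sets in place of $(p,q)$-$(V)$ sets. Here a set in a locally convex space $F$ is relatively weakly compact if its weak closure is weakly compact, relatively weakly sequentially compact if each sequence in it has a subsequence weakly converging to a point of $F$, and weakly sequentially precompact if each sequence in it has a weakly Cauchy subsequence. *)

theory Defs
  imports "HOL-Analysis.Analysis" "HOL-Library.Function_Algebras"
begin

text \<open>
  A topological vector space over the scalar field \<open>'k\<close> is given by its scalar multiplication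
  \<open>s\<close> and its topology \<open>T\<close>; the underlying vector space is \<^term>\<open>topspace T\<close>, a subspace of the
  ambient type. Functions on a proper subset of a type, and functionals on such a space, are
  represented by their extensions by zero, so that they form vector spaces under the pointwise
  operations.
\<close>

definition fun_scale :: "'k::real_normed_field \<Rightarrow> ('a \<Rightarrow> 'k) \<Rightarrow> 'a \<Rightarrow> 'k" where
  "fun_scale c f = (\<lambda>x. c * f x)"

definition functions_on :: "'a set \<Rightarrow> ('a \<Rightarrow> 'k::real_normed_field) set" where
  "functions_on A = {f. \<forall>x. x \<notin> A \<longrightarrow> f x = 0}"


subsection \<open>Duals, weak and strong topologies\<close>

definition dual_space ::
    "('k::real_normed_field \<Rightarrow> 'v::ab_group_add \<Rightarrow> 'v) \<Rightarrow> 'v topology \<Rightarrow> ('v \<Rightarrow> 'k) set" where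
  "dual_space s T = {\<xi> \<in> functions_on (topspace T).
     continuous_map T euclidean \<xi> \<and>
     (\<forall>x\<in>topspace T. \<forall>y\<in>topspace T. \<xi> (x + y) = \<xi> x + \<xi> y) \<and>
     (\<forall>c. \<forall>x\<in>topspace T. \<xi> (s c x) = c * \<xi> x)}"

definition weak_topology ::
    "('k::real_normed_field \<Rightarrow> 'v::ab_group_add \<Rightarrow> 'v) \<Rightarrow> 'v topology \<Rightarrow> 'v topology" where
  "weak_topology s T =
     topology_generated_by {{x \<in> topspace T. \<xi> x \<in> U} |\<xi> U. \<xi> \<in> dual_space s T \<and> open U}"

definition tvs_bounded ::
    "('k::real_normed_field \<Rightarrow> 'v::ab_group_add \<Rightarrow> 'v) \<Rightarrow> 'v topology \<Rightarrow> 'v set \<Rightarrow> bool" where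
  "tvs_bounded s T A \<longleftrightarrow> A \<subseteq> topspace T \<and>
     (\<forall>U. openin T U \<and> 0 \<in> U \<longrightarrow> (\<exists>t>0. \<forall>c. norm c \<ge> t \<longrightarrow> A \<subseteq> s c ` U))"

text \<open>The strong dual: uniform convergence on the bounded subsets of the space.\<close>

definition strong_dual ::
    "('k::real_normed_field \<Rightarrow> 'v::ab_group_add \<Rightarrow> 'v) \<Rightarrow> 'v topology \<Rightarrow> ('v \<Rightarrow> 'k) topology" where
  "strong_dual s T = topology (\<lambda>W. W \<subseteq> dual_space s T \<and>
     (\<forall>\<xi>\<in>W. \<exists>A \<epsilon>. tvs_bounded s T A \<and> \<epsilon> > 0 \<and>
        {\<eta> \<in> dual_space s T. \<forall>x\<in>A. norm (\<eta> x - \<xi> x) < \<epsilon>} \<subseteq> W))"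

lemma tvs_bounded_Un:
  assumes "tvs_bounded s T A" "tvs_bounded s T B"
  shows "tvs_bounded s T (A \<union> B)"
  unfolding tvs_bounded_def
proof (intro conjI allI impI)
  show "A \<union> B \<subseteq> topspace T"
    using assms by (auto simp: tvs_bounded_def)
  fix U assume U: "openin T U \<and> 0 \<in> U"
  obtain a where "a > 0" and a: "\<And>c. norm c \<ge> a \<Longrightarrow> A \<subseteq> s c ` U"
    using U assms(1) unfolding tvs_bounded_def by meson
  obtain b where "b > 0" and b: "\<And>c. norm c \<ge> b \<Longrightarrow> B \<subseteq> s c ` U"
    using U assms(2) unfolding tvs_bounded_def by meson
  show "\<exists>t>0. \<forall>c. norm c \<ge> t \<longrightarrow> A \<union> B \<subseteq> s c ` U"
    using \<open>a > 0\<close> a b by (intro exI[of _ "max a b"]) auto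
qed

lemma openin_strong_dual:
  "openin (strong_dual s T) W \<longleftrightarrow> W \<subseteq> dual_space s T \<and>
     (\<forall>\<xi>\<in>W. \<exists>A \<epsilon>. tvs_bounded s T A \<and> \<epsilon> > 0 \<and>
        {\<eta> \<in> dual_space s T. \<forall>x\<in>A. norm (\<eta> x - \<xi> x) < \<epsilon>} \<subseteq> W)"
proof -
  let ?N = "\<lambda>\<xi> A \<epsilon>. {\<eta> \<in> dual_space s T. \<forall>x\<in>A. norm (\<eta> x - \<xi> x) < \<epsilon>}"
  let ?L = "\<lambda>W. W \<subseteq> dual_space s T \<and>
     (\<forall>\<xi>\<in>W. \<exists>A \<epsilon>. tvs_bounded s T A \<and> \<epsilon> > 0 \<and> ?N \<xi> A \<epsilon> \<subseteq> W)"
  have "istopology ?L"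
    unfolding istopology_def
  proof (intro conjI allI impI)
    fix V W assume V: "?L V" and W: "?L W"
    show "V \<inter> W \<subseteq> dual_space s T"
      using conjunct1[OF V] by (rule le_infI1)
    show "\<forall>\<xi>\<in>V \<inter> W. \<exists>A \<epsilon>. tvs_bounded s T A \<and> \<epsilon> > 0 \<and> ?N \<xi> A \<epsilon> \<subseteq> V \<inter> W"
    proof
      fix \<xi> assume "\<xi> \<in> V \<inter> W"
      then have "\<xi> \<in> V" "\<xi> \<in> W" by simp_all
      obtain A a where A: "tvs_bounded s T A" "a > 0" "?N \<xi> A a \<subseteq> V"
        using bspec[OF conjunct2[OF V] \<open>\<xi> \<in> V\<close>] by (elim exE conjE)
      obtain B b where B: "tvs_bounded s T B" "b > 0" "?N \<xi> B b \<subseteq> W"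
        using bspec[OF conjunct2[OF W] \<open>\<xi> \<in> W\<close>] by (elim exE conjE)
      have "?N \<xi> (A \<union> B) (min a b) \<subseteq> ?N \<xi> A a \<inter> ?N \<xi> B b"
        by auto
      also have "\<dots> \<subseteq> V \<inter> W"
        using A(3) B(3) by (rule Int_mono)
      finally have "?N \<xi> (A \<union> B) (min a b) \<subseteq> V \<inter> W" .
      moreover have "min a b > 0"
        using A(2) B(2) by simp
      ultimately show "\<exists>A \<epsilon>. tvs_bounded s T A \<and> \<epsilon> > 0 \<and> ?N \<xi> A \<epsilon> \<subseteq> V \<inter> W"
        using tvs_bounded_Un[OF A(1) B(1)] by (intro exI conjI)
    qed
  next
    fix \<K> assume *: "\<forall>K\<in>\<K>. ?L K"
    show "\<Union>\<K> \<subseteq> dual_space s T"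
      by (intro Union_least conjunct1[OF bspec[OF *]])
    show "\<forall>\<xi>\<in>\<Union>\<K>. \<exists>A \<epsilon>. tvs_bounded s T A \<and> \<epsilon> > 0 \<and> ?N \<xi> A \<epsilon> \<subseteq> \<Union>\<K>"
    proof
      fix \<xi> assume "\<xi> \<in> \<Union>\<K>"
      then obtain K where K: "K \<in> \<K>" "\<xi> \<in> K" by blast
      obtain A a where A: "tvs_bounded s T A" "a > 0" "?N \<xi> A a \<subseteq> K"
        using bspec[OF conjunct2[OF bspec[OF * K(1)]] K(2)] by (elim exE conjE)
      have "?N \<xi> A a \<subseteq> \<Union>\<K>"
        using A(3) Union_upper[OF K(1)] by (rule subset_trans)
      then show "\<exists>A \<epsilon>. tvs_bounded s T A \<and> \<epsilon> > 0 \<and> ?N \<xi> A \<epsilon> \<subseteq> \<Union>\<K>"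
        using A(1,2) by (intro exI conjI)
    qed
  qed
  then show ?thesis
    unfolding strong_dual_def by (simp only: topology_inverse')
qed

definition polar ::
    "('k::real_normed_field \<Rightarrow> 'v::ab_group_add \<Rightarrow> 'v) \<Rightarrow> 'v topology \<Rightarrow> 'v set \<Rightarrow> ('v \<Rightarrow> 'k) set" where
  "polar s T U = {\<xi> \<in> dual_space s T. \<forall>x\<in>U. norm (\<xi> x) \<le> 1}"

definition equicontinuous_set ::
    "('k::real_normed_field \<Rightarrow> 'v::ab_group_add \<Rightarrow> 'v) \<Rightarrow> 'v topology \<Rightarrow> ('v \<Rightarrow> 'k) set \<Rightarrow> bool" where
  "equicontinuous_set s T B \<longleftrightarrow>
     (\<exists>U. U \<subseteq> topspace T \<and> 0 \<in> T interior_of U \<and> B \<subseteq> polar s T U)"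


subsection \<open>Weak compactness notions\<close>

definition relatively_weakly_compact ::
    "('k::real_normed_field \<Rightarrow> 'v::ab_group_add \<Rightarrow> 'v) \<Rightarrow> 'v topology \<Rightarrow> 'v set \<Rightarrow> bool" where
  "relatively_weakly_compact s T A \<longleftrightarrow> A \<subseteq> topspace T \<and>
     compactin (weak_topology s T) (weak_topology s T closure_of A)"

definition relatively_weakly_seq_compact ::
    "('k::real_normed_field \<Rightarrow> 'v::ab_group_add \<Rightarrow> 'v) \<Rightarrow> 'v topology \<Rightarrow> 'v set \<Rightarrow> bool" where
  "relatively_weakly_seq_compact s T A \<longleftrightarrow> A \<subseteq> topspace T \<and>
     (\<forall>x::nat \<Rightarrow> 'v. range x \<subseteq> A \<longrightarrow>
        (\<exists>\<phi> l. strict_mono \<phi> \<and> l \<in> topspace T \<and>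
           limitin (weak_topology s T) (x \<circ> \<phi>) l sequentially))"

definition weakly_Cauchy ::
    "('k::real_normed_field \<Rightarrow> 'v::ab_group_add \<Rightarrow> 'v) \<Rightarrow> 'v topology \<Rightarrow> (nat \<Rightarrow> 'v) \<Rightarrow> bool" where
  "weakly_Cauchy s T x \<longleftrightarrow>
     (\<forall>U. openin (weak_topology s T) U \<and> 0 \<in> U \<longrightarrow> (\<exists>N. \<forall>m\<ge>N. \<forall>n\<ge>N. x m - x n \<in> U))"

definition weakly_seq_precompact ::
    "('k::real_normed_field \<Rightarrow> 'v::ab_group_add \<Rightarrow> 'v) \<Rightarrow> 'v topology \<Rightarrow> 'v set \<Rightarrow> bool" where
  "weakly_seq_precompact s T A \<longleftrightarrow> A \<subseteq> topspace T \<and>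
     (\<forall>x::nat \<Rightarrow> 'v. range x \<subseteq> A \<longrightarrow> (\<exists>\<phi>. strict_mono \<phi> \<and> weakly_Cauchy s T (x \<circ> \<phi>)))"


subsection \<open>\<open>(p,q)\<close>-\<open>(V)\<close> and \<open>(p,q)\<close>-\<open>(EV)\<close> sets and the associated properties\<close>

text \<open>Membership in \<open>\<ell>\<^sub>p\<close>, with \<open>c\<^sub>0\<close> (not \<open>\<ell>\<^sub>\<infinity>\<close>) for \<open>p = \<infinity>\<close>; used only for \<open>p \<ge> 1\<close>.\<close>

definition lp_c0_seq :: "ereal \<Rightarrow> (nat \<Rightarrow> 'b::real_normed_vector) \<Rightarrow> bool" where
  "lp_c0_seq p a \<longleftrightarrow>
     (if p = \<infinity> then a \<longlonglongrightarrow> 0 else summable (\<lambda>n. norm (a n) powr real_of_ereal p))"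

definition weakly_p_summable ::
    "ereal \<Rightarrow> ('k::real_normed_field \<Rightarrow> 'v::ab_group_add \<Rightarrow> 'v) \<Rightarrow> 'v topology \<Rightarrow> (nat \<Rightarrow> 'v) \<Rightarrow> bool" where
  "weakly_p_summable p s T x \<longleftrightarrow>
     range x \<subseteq> topspace T \<and> (\<forall>\<xi>\<in>dual_space s T. lp_c0_seq p (\<lambda>n. \<xi> (x n)))"

text \<open>
  The suprema have to be finite for the sequence to lie in \<open>\<ell>\<^sub>q\<close> or \<open>c\<^sub>0\<close>; this is stated
  separately since the real-valued \<open>SUP\<close> of an unbounded family is meaningless.
\<close>

definition pq_V_set ::
    "ereal \<Rightarrow> ereal \<Rightarrow> ('k::real_normed_field \<Rightarrow> 'v::ab_group_add \<Rightarrow> 'v) \<Rightarrow> 'v topology \<Rightarrow>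
     ('v \<Rightarrow> 'k) set \<Rightarrow> bool" where
  "pq_V_set p q s T B \<longleftrightarrow> B \<noteq> {} \<and> B \<subseteq> dual_space s T \<and>
     (\<forall>x. weakly_p_summable p s T x \<longrightarrow>
        (\<forall>n. bdd_above ((\<lambda>\<xi>. norm (\<xi> (x n))) ` B)) \<and>
        lp_c0_seq q (\<lambda>n. SUP \<xi>\<in>B. norm (\<xi> (x n))))"

definition pq_EV_set ::
    "ereal \<Rightarrow> ereal \<Rightarrow> ('k::real_normed_field \<Rightarrow> 'v::ab_group_add \<Rightarrow> 'v) \<Rightarrow> 'v topology \<Rightarrow>
     ('v \<Rightarrow> 'k) set \<Rightarrow> bool" where
  "pq_EV_set p q s T B \<longleftrightarrow> pq_V_set p q s T B \<and> equicontinuous_set s T B"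

definition property_V ::
    "ereal \<Rightarrow> ereal \<Rightarrow> ('k::real_normed_field \<Rightarrow> 'v::ab_group_add \<Rightarrow> 'v) \<Rightarrow> 'v topology \<Rightarrow> bool" where
  "property_V p q s T \<longleftrightarrow>
     (\<forall>B. pq_V_set p q s T B \<longrightarrow> relatively_weakly_compact fun_scale (strong_dual s T) B)"

definition property_sV ::
    "ereal \<Rightarrow> ereal \<Rightarrow> ('k::real_normed_field \<Rightarrow> 'v::ab_group_add \<Rightarrow> 'v) \<Rightarrow> 'v topology \<Rightarrow> bool" where
  "property_sV p q s T \<longleftrightarrow>
     (\<forall>B. pq_V_set p q s T B \<longrightarrow> relatively_weakly_seq_compact fun_scale (strong_dual s T) B)"

definition property_wsV ::
    "ereal \<Rightarrow> ereal \<Rightarrow> ('k::real_normed_field \<Rightarrow> 'v::ab_group_add \<Rightarrow> 'v) \<Rightarrow> 'v topology \<Rightarrow> bool" where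
  "property_wsV p q s T \<longleftrightarrow>
     (\<forall>B. pq_V_set p q s T B \<longrightarrow> weakly_seq_precompact fun_scale (strong_dual s T) B)"

definition property_EV ::
    "ereal \<Rightarrow> ereal \<Rightarrow> ('k::real_normed_field \<Rightarrow> 'v::ab_group_add \<Rightarrow> 'v) \<Rightarrow> 'v topology \<Rightarrow> bool" where
  "property_EV p q s T \<longleftrightarrow>
     (\<forall>B. pq_EV_set p q s T B \<longrightarrow> relatively_weakly_compact fun_scale (strong_dual s T) B)"

definition property_sEV ::
    "ereal \<Rightarrow> ereal \<Rightarrow> ('k::real_normed_field \<Rightarrow> 'v::ab_group_add \<Rightarrow> 'v) \<Rightarrow> 'v topology \<Rightarrow> bool" where
  "property_sEV p q s T \<longleftrightarrow>
     (\<forall>B. pq_EV_set p q s T B \<longrightarrow> relatively_weakly_seq_compact fun_scale (strong_dual s T) B)"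

definition property_wsEV ::
    "ereal \<Rightarrow> ereal \<Rightarrow> ('k::real_normed_field \<Rightarrow> 'v::ab_group_add \<Rightarrow> 'v) \<Rightarrow> 'v topology \<Rightarrow> bool" where
  "property_wsEV p q s T \<longleftrightarrow>
     (\<forall>B. pq_EV_set p q s T B \<longrightarrow> weakly_seq_precompact fun_scale (strong_dual s T) B)"


subsection \<open>The function spaces\<close>

definition continuous_functions :: "'a topology \<Rightarrow> ('a \<Rightarrow> 'k::real_normed_field) set" where
  "continuous_functions X = {f \<in> functions_on (topspace X). continuous_map X euclidean f}"

text \<open>
  Topology of pointwise convergence on a set \<open>S\<close> of functions extended by zero. Coordinates
  outside the domain are constantly zero on \<open>S\<close>, so taking the product over the whole type gives
  the topology induced from the product over the domain.
\<close>

definition pointwise_topology :: "('a \<Rightarrow> 'k::real_normed_field) set \<Rightarrow> ('a \<Rightarrow> 'k) topology" where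
  "pointwise_topology S = subtopology (product_topology (\<lambda>_. euclidean) UNIV) S"

definition Cp_space :: "'a topology \<Rightarrow> ('a \<Rightarrow> 'k::real_normed_field) topology" where
  "Cp_space X = pointwise_topology (continuous_functions X)"

text \<open>
  The ordinal \<open>\<alpha>\<close> is an element of the field of a well-order \<open>r\<close>, standing for the order type of
  its set \<^term>\<open>underS r \<alpha>\<close> of strict predecessors; it is countable iff that set is. The Baire classes are
  defined by transfinite recursion along \<open>r\<close>.
\<close>

definition baire_class ::
    "'a topology \<Rightarrow> 'o rel \<Rightarrow> 'o \<Rightarrow> ('a \<Rightarrow> 'k::real_normed_field) set" where
  "baire_class X r = wo_rel.worec r (\<lambda>B \<alpha>.
     if underS r \<alpha> = {} then continuous_functions X
     else {f \<in> functions_on (topspace X). \<exists>g::nat \<Rightarrow> 'a \<Rightarrow> 'k.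
             (\<forall>n. g n \<in> (\<Union>\<beta>\<in>underS r \<alpha>. B \<beta>)) \<and>
             (\<forall>x\<in>topspace X. (\<lambda>n. g n x) \<longlonglongrightarrow> f x)})"

lemma baire_class_unfold:
  assumes "Well_order r"
  shows "(baire_class X r \<alpha> :: ('a \<Rightarrow> 'k::real_normed_field) set) =
    (if underS r \<alpha> = {} then continuous_functions X
     else {f \<in> functions_on (topspace X). \<exists>g::nat \<Rightarrow> 'a \<Rightarrow> 'k.
             (\<forall>n. g n \<in> (\<Union>\<beta>\<in>underS r \<alpha>. baire_class X r \<beta>)) \<and>
             (\<forall>x\<in>topspace X. (\<lambda>n. g n x) \<longlonglongrightarrow> f x)})"
proof -
  interpret wo_rel r
    using assms by (simp add: wo_rel_def)
  define H :: "('b \<Rightarrow> ('a \<Rightarrow> 'k) set) \<Rightarrow> 'b \<Rightarrow> ('a \<Rightarrow> 'k) set" where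
    "H = (\<lambda>B \<alpha>. if underS \<alpha> = {} then continuous_functions X
     else {f \<in> functions_on (topspace X). \<exists>g::nat \<Rightarrow> 'a \<Rightarrow> 'k.
             (\<forall>n. g n \<in> (\<Union>\<beta>\<in>underS \<alpha>. B \<beta>)) \<and>
             (\<forall>x\<in>topspace X. (\<lambda>n. g n x) \<longlonglongrightarrow> f x)})"
  have "adm_wo H"
    unfolding adm_wo_def H_def by simp
  then have *: "worec H = H (worec H)"
    by (rule worec_fixpoint)
  have "baire_class X r = worec H"
    unfolding baire_class_def H_def ..
  then have "baire_class X r = H (baire_class X r)"
    by (rule ssubst) (rule *)
  then have "baire_class X r \<alpha> = H (baire_class X r) \<alpha>"
    by (rule fun_cong)
  then show ?thesis
    unfolding H_def .
qed

definition baire_space ::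
    "'a topology \<Rightarrow> 'o rel \<Rightarrow> 'o \<Rightarrow> ('a \<Rightarrow> 'k::real_normed_field) topology" where
  "baire_space X r \<alpha> = pointwise_topology (baire_class X r \<alpha>)"

end

theory Submission
  imports Defs
begin

text \<open>
  The topology of pointwise convergence is so weak that a \<open>(p,q)\<close>-\<open>(V)\<close> set \<open>B\<close> has to be a bounded
  subset of a finite-dimensional subspace of the dual; there all the notions of weak compactness
  and precompactness reduce to the theorem of Heine and Borel.

  Let \<open>S\<close> be a vector space of functions on \<open>X\<close> containing the continuous ones. A neighbourhood of
  zero in \<open>S\<close> restricts only finitely many coordinates, so that every continuous functional on \<open>S\<close> is
  a finite linear combination of point evaluations (\<open>dual_is_combination\<close>). Hence a sequence \<open>g\<^sub>n\<close>
  in \<open>S\<close> such that at every point of \<open>X\<close> all but finitely many \<open>g\<^sub>n\<close> vanish is weakly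
  \<open>p\<close>-summable for every \<open>p\<close>: against each functional it gives a finitely supported scalar sequence.

  Suppose that the functionals in \<open>B\<close> involve infinitely many points altogether. A Tychonoff space
  has pairwise disjoint open sets \<open>U\<^sub>n\<close> each of which contains one of these points. Inside
  \<open>U\<^sub>n\<close> a bump function that avoids the other points of the functional concerned can be normed so
  that this functional takes the value \<open>1\<close> on it. This is a weakly \<open>p\<close>-summable sequence on which
  the suprema over \<open>B\<close> are at least \<open>1\<close>, hence neither in \<open>\<ell>\<^sub>q\<close> nor in \<open>c\<^sub>0\<close>, a contradiction
  (\<open>pq_V_set_finite_supports\<close>). So \<open>B\<close> lives on a finite set \<open>F\<close>, and testing \<open>B\<close> on bump functions at
  the points of \<open>F\<close> bounds the coefficients (\<open>pq_V_set_subset_polydisc\<close>).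

  Finally, the map from coefficients on \<open>F\<close> to functionals is continuous into the weak topology of the
  strong dual because every linear functional is continuous on a finite-dimensional space
  (\<open>continuous_map_combination\<close>). It carries the compact polydisc that bounds the coefficients of \<open>B\<close>,
  together with its convergent sequences, to weakly compact sets and weakly convergent sequences.

  The Baire classes are such spaces \<open>S\<close>, which is shown by transfinite induction.
\<close>

section \<open>Coefficient sequences\<close>

lemma lp_c0_seq_finite_support:
  assumes fin: "finite {n. a n \<noteq> 0}"
  shows "lp_c0_seq p a"
proof (cases "p = \<infinity>")
  case True
  have "eventually (\<lambda>n. a n = 0) sequentially"
    using fin by (simp add: cofinite_eq_sequentially[symmetric] eventually_cofinite)
  then have "a \<longlonglongrightarrow> 0"
    by (rule tendsto_eventually)
  with True show ?thesis by (simp add: lp_c0_seq_def)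
next
  case False
  have "summable (\<lambda>n. norm (a n) powr real_of_ereal p)"
    using fin by (rule summable_finite) simp
  with False show ?thesis by (simp add: lp_c0_seq_def)
qed

lemma not_lp_c0_seq_if_norm_ge_1:
  assumes "1 \<le> q" and ge: "\<And>n. norm (a n) \<ge> 1"
  shows "\<not> lp_c0_seq q a"
proof
  assume lp: "lp_c0_seq q a"
  have "\<exists>b::nat \<Rightarrow> real. b \<longlonglongrightarrow> 0 \<and> (\<forall>n. b n \<ge> 1)"
  proof (cases "q = \<infinity>")
    case True
    then have "(\<lambda>n. norm (a n)) \<longlonglongrightarrow> 0"
      using lp by (simp add: lp_c0_seq_def tendsto_norm_zero_iff)
    with ge show ?thesis by blast
  next
    case False
    then have "(\<lambda>n. norm (a n) powr real_of_ereal q) \<longlonglongrightarrow> 0"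
      using lp by (simp add: lp_c0_seq_def summable_LIMSEQ_zero)
    moreover have "real_of_ereal q \<ge> 0"
      using \<open>1 \<le> q\<close> by (cases q) auto
    ultimately show ?thesis
      using ge ge_one_powr_ge_zero by blast
  qed
  then obtain b :: "nat \<Rightarrow> real" where "b \<longlonglongrightarrow> 0" "\<And>n. b n \<ge> 1" by blast
  then have "(0::real) \<ge> 1"
    by (intro LIMSEQ_le_const) auto
  then show False by simp
qed

lemma bounded_coordinates_convergent_subseq:
  fixes a :: "nat \<Rightarrow> 'i \<Rightarrow> 'k::{real_normed_vector,heine_borel}"
  assumes "finite F" and "\<And>n x. x \<in> F \<Longrightarrow> norm (a n x) \<le> M x"
  shows "\<exists>\<phi> b. strict_mono \<phi> \<and> (\<forall>x\<in>F. (\<lambda>n. a (\<phi> n) x) \<longlonglongrightarrow> b x)"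
  using assms
proof (induction F rule: finite_induct)
  case empty
  show ?case by (intro exI[of _ id]) (auto simp: strict_mono_def)
next
  case (insert y F)
  then obtain \<phi> b where \<phi>: "strict_mono (\<phi> :: nat \<Rightarrow> nat)"
    and lim: "\<And>x. x \<in> F \<Longrightarrow> (\<lambda>n. a (\<phi> n) x) \<longlonglongrightarrow> b x" by blast
  have "bounded (range (\<lambda>n. a (\<phi> n) y))"
    unfolding bounded_iff using insert.prems by blast
  then obtain l \<psi> where \<psi>: "strict_mono (\<psi> :: nat \<Rightarrow> nat)"
    and l: "((\<lambda>n. a (\<phi> n) y) \<circ> \<psi>) \<longlonglongrightarrow> l"
    using bounded_imp_convergent_subsequence by blast
  have "(\<lambda>n. a ((\<phi> \<circ> \<psi>) n) x) \<longlonglongrightarrow> (b(y := l)) x" if "x \<in> insert y F" for x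
  proof (cases "x = y")
    case True
    with l show ?thesis by (simp add: o_def)
  next
    case False
    with that have "((\<lambda>n. a (\<phi> n) x) \<circ> \<psi>) \<longlonglongrightarrow> b x"
      using lim \<psi> by (intro LIMSEQ_subseq_LIMSEQ) auto
    with False show ?thesis by (simp add: o_def)
  qed
  with \<phi> \<psi> show ?case
    by (intro exI[of _ "\<phi> \<circ> \<psi>"] exI[of _ "b(y := l)"]) (auto simp: strict_mono_def)
qed


section \<open>Disjoint open sets meeting an infinite set\<close>

text \<open>
  Separate two points \<open>x\<close> and \<open>y\<close> of \<open>A \<inter> W\<close> by disjoint open sets \<open>U\<close> and \<open>V\<close>. If \<open>V\<close> contains infinitely
  many points of \<open>A\<close>, then \<open>U\<close> can be split off. Otherwise infinitely many points of \<open>A\<close> survive outside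
  \<open>V\<close>, and so outside a closed neighbourhood \<open>C\<close> of \<open>y\<close> inside \<open>V\<close>; an open set around \<open>y\<close> inside \<open>C\<close> is
  split off.
\<close>

lemma regular_Hausdorff_split_infinite:
  assumes reg: "regular_space X" and haus: "Hausdorff_space X"
    and W: "openin X W" "infinite (A \<inter> W)"
  shows "\<exists>x U V. openin X U \<and> openin X V \<and> U \<inter> V = {} \<and> U \<union> V \<subseteq> W \<and>
           x \<in> A \<inter> U \<and> infinite (A \<inter> V)"
proof -
  obtain x where x: "x \<in> A \<inter> W"
    using W(2) finite.emptyI by (metis ex_in_conv)
  have "infinite (A \<inter> W - {x})"
    using W(2) by simp
  then obtain y where y: "y \<in> A \<inter> W" "y \<noteq> x"
    by (metis DiffE ex_in_conv finite.emptyI insertI1)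
  have "x \<in> topspace X" "y \<in> topspace X"
    using x y W(1) openin_subset by blast+
  then obtain U0 V0 where UV: "openin X U0" "openin X V0" "x \<in> U0" "y \<in> V0" "disjnt U0 V0"
    using haus y(2) unfolding Hausdorff_space_def by metis
  define U where "U = U0 \<inter> W"
  define V where "V = V0 \<inter> W"
  have U: "openin X U" "x \<in> U" "U \<subseteq> W" and V: "openin X V" "y \<in> V" "V \<subseteq> W" and "U \<inter> V = {}"
    using UV x y W(1) by (auto simp: U_def V_def disjnt_def)
  show ?thesis
  proof (cases "infinite (A \<inter> V)")
    case True
    with U V \<open>U \<inter> V = {}\<close> x show ?thesis by blast
  next
    case False
    obtain N C where NC: "openin X N" "closedin X C" "y \<in> N" "N \<subseteq> C" "C \<subseteq> V"
      using reg V(1,2) unfolding neighbourhood_base_of_closedin[symmetric] neighbourhood_base_of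
      by metis
    have "A \<inter> W - A \<inter> V \<subseteq> A \<inter> (W - C)"
      using NC(5) by blast
    moreover have "infinite (A \<inter> W - A \<inter> V)"
      using False W(2) by (simp add: Diff_infinite_finite)
    ultimately have "infinite (A \<inter> (W - C))"
      using finite_subset by blast
    moreover have "openin X (W - C)"
      using W(1) NC(2) by (rule openin_diff)
    ultimately show ?thesis
      using NC y V(3) by (intro exI[of _ y] exI[of _ N] exI[of _ "W - C"]) auto
  qed
qed

lemma regular_Hausdorff_disjoint_open_sequence:
  assumes reg: "regular_space X" and haus: "Hausdorff_space X"
    and A: "A \<subseteq> topspace X" "infinite A"
  obtains x U where "\<And>n::nat. openin X (U n)" "\<And>n. x n \<in> A \<inter> U n"
    and "\<And>m n. m \<noteq> n \<Longrightarrow> U m \<inter> U n = {}"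
proof -
  define P where "P = (\<lambda>(x, U, V). openin X U \<and> openin X V \<and> U \<inter> V = {} \<and>
    x \<in> A \<inter> U \<and> infinite (A \<inter> V))"
  \<comment> \<open>At each stage the next triple is found inside the reserve \<open>V\<close> of the previous one.\<close>
  define Q where "Q = (\<lambda>(x :: 'a, U :: 'a set, V :: 'a set) (x' :: 'a, U', V'). U' \<union> V' \<subseteq> V)"
  have "\<exists>t. \<forall>n::nat. P (t n) \<and> Q (t n) (t (Suc n))"
  proof (rule dependent_nat_choice)
    have "infinite (A \<inter> topspace X)"
      using A by (simp add: inf_absorb1)
    from regular_Hausdorff_split_infinite[OF reg haus openin_topspace this]
    show "\<exists>t. P t" by (auto simp: P_def)
  next
    fix t :: "'a \<times> 'a set \<times> 'a set" and n :: nat assume "P t"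
    moreover obtain x U V where "t = (x, U, V)" by (cases t)
    ultimately show "\<exists>t'. P t' \<and> Q t t'"
      using regular_Hausdorff_split_infinite[OF reg haus, of V A] by (auto simp: P_def Q_def)
  qed
  then obtain t where t: "\<And>n::nat. P (t n)" "\<And>n. Q (t n) (t (Suc n))" by blast
  define x where "x = (\<lambda>n. fst (t n))"
  define U where "U = (\<lambda>n. fst (snd (t n)))"
  define V where "V = (\<lambda>n. snd (snd (t n)))"
  have P: "openin X (U n)" "U n \<inter> V n = {}" "x n \<in> A \<inter> U n" for n
    using t(1)[of n] by (auto simp: P_def x_def U_def V_def split_beta)
  have Q: "U (Suc n) \<subseteq> V n" "V (Suc n) \<subseteq> V n" for n
    using t(2)[of n] by (auto simp: Q_def U_def V_def split_beta)
  have V_anti: "V n \<subseteq> V m" if "m \<le> n" for m n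
    using that Q(2) by (rule lift_Suc_antimono_le[rotated])
  have disj: "U m \<inter> U n = {}" if "m < n" for m n
  proof -
    obtain k where k: "n = Suc k" "m \<le> k"
      using \<open>m < n\<close> by (metis Suc_le_D Suc_le_mono Suc_leI)
    have "U n \<subseteq> V m"
      using Q(1)[of k] V_anti[OF k(2)] k(1) by blast
    with P(2)[of m] show ?thesis by blast
  qed
  show ?thesis
  proof (rule that)
    show "U m \<inter> U n = {}" if "m \<noteq> n" for m n
      using disj[of m n] disj[of n m] that by (cases m n rule: linorder_cases) auto
  qed (use P in auto)
qed


section \<open>Function spaces with the topology of pointwise convergence\<close>

lemma sum_fun_apply: "(\<Sum>x\<in>F. f x) y = (\<Sum>x\<in>F. f x y)"
  by (induction F rule: infinite_finite_induct) auto

lemma continuous_map_mult_left: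
  fixes f :: "'b \<Rightarrow> 'k::real_normed_algebra"
  assumes "continuous_map T euclidean f"
  shows "continuous_map T euclidean (\<lambda>x. c * f x)"
  using assms by (simp add: continuous_map_atin tendsto_mult_left)

lemma continuous_map_mult_right:
  fixes f :: "'b \<Rightarrow> 'k::real_normed_algebra"
  assumes "continuous_map T euclidean f"
  shows "continuous_map T euclidean (\<lambda>x. f x * c)"
  using assms by (simp add: continuous_map_atin tendsto_mult_right)

text \<open>
  The common properties of the continuous functions and of all Baire classes on a Tychonoff space.
\<close>

locale pointwise_function_space =
  fixes X :: "'a topology" and S :: "('a \<Rightarrow> 'k::{real_normed_field,heine_borel}) set"
  assumes completely_regular: "completely_regular_space X" and t1: "t1_space X"
    and continuous_in: "continuous_functions X \<subseteq> S"
    and outside: "S \<subseteq> functions_on (topspace X)"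
    and add_in: "f \<in> S \<Longrightarrow> g \<in> S \<Longrightarrow> f + g \<in> S"
    and scale_in: "f \<in> S \<Longrightarrow> fun_scale c f \<in> S"
begin

abbreviation space :: "('a \<Rightarrow> 'k) topology" where
  "space \<equiv> pointwise_topology S"

abbreviation dual :: "(('a \<Rightarrow> 'k) \<Rightarrow> 'k) set" where
  "dual \<equiv> dual_space fun_scale space"

abbreviation strong :: "(('a \<Rightarrow> 'k) \<Rightarrow> 'k) topology" where
  "strong \<equiv> strong_dual fun_scale space"

lemma topspace_space [simp]: "topspace space = S"
  by (simp add: pointwise_topology_def)

lemma zero_in: "0 \<in> S"
proof -
  have "(\<lambda>_. 0) \<in> continuous_functions X"
    by (simp add: continuous_functions_def functions_on_def)
  with continuous_in show ?thesis by (auto simp: zero_fun_def)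
qed

lemma sum_in: "(\<And>x. x \<in> F \<Longrightarrow> f x \<in> S) \<Longrightarrow> (\<Sum>x\<in>F. f x) \<in> S"
  by (induction F rule: infinite_finite_induct) (auto intro: zero_in add_in)

lemma continuous_map_eval: "continuous_map space euclidean (\<lambda>f. f x)"
  unfolding pointwise_topology_def
  by (intro continuous_map_from_subtopology continuous_map_product_projection) auto

lemma regular: "regular_space X" and Hausdorff: "Hausdorff_space X"
  using completely_regular t1 completely_regular_imp_regular_space regular_t1_imp_Hausdorff_space
  by blast+

text \<open>
  Finitely many points of a \<open>T\<^sub>1\<close> space form a closed set, so a function separating \<open>x\<close> from the
  complement of \<open>U\<close> can be made to vanish at the other points of \<open>F\<close> as well.
\<close>

lemma bump_function:
  assumes "openin X U" "x \<in> U" "finite F"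
  obtains f where "f \<in> S" "f x = 1" "\<And>y. y \<in> F \<Longrightarrow> y \<noteq> x \<Longrightarrow> f y = 0" "\<And>y. y \<notin> U \<Longrightarrow> f y = 0"
proof -
  define C where "C = (topspace X - U) \<union> (topspace X \<inter> F - {x})"
  have x: "x \<in> topspace X"
    using assms openin_subset by blast
  have "closedin X (topspace X \<inter> F - {x})"
    using t1 assms(3) unfolding t1_space_closedin_finite by (meson Diff_subset Int_lower1 finite_Diff finite_Int order_trans)
  then have "closedin X C"
    unfolding C_def using assms(1) by (intro closedin_Un) auto
  moreover have "x \<in> topspace X - C"
    using assms(2) x by (simp add: C_def)
  ultimately obtain h :: "'a \<Rightarrow> real" where h: "continuous_map X (top_of_set {0..1}) h"
      "h x = 0" "h ` C \<subseteq> {1}"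
    using completely_regular unfolding completely_regular_space_def by meson
  define f :: "'a \<Rightarrow> 'k" where "f = (\<lambda>y. if y \<in> topspace X then of_real (1 - h y) else 0)"
  have hc: "continuous_map X euclidean h"
    using h(1) by (simp add: continuous_map_in_subtopology)
  have "continuous_map X euclidean (\<lambda>y. 1 - h y)"
    using hc by (intro continuous_intros) auto
  moreover have "continuous_map euclidean euclidean (of_real :: real \<Rightarrow> 'k)"
    by (simp add: continuous_on_of_real)
  ultimately have "continuous_map X euclidean ((of_real :: real \<Rightarrow> 'k) \<circ> (\<lambda>y. 1 - h y))"
    by (rule continuous_map_compose)
  then have "continuous_map X euclidean f"
    by (rule continuous_map_eq) (simp add: f_def)
  then have "f \<in> S"
    using continuous_in by (auto simp: continuous_functions_def functions_on_def f_def)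
  moreover have h1: "h y = 1" if "y \<in> C" for y
    using h(3) that by auto
  have "f y = 0" if "y \<in> F" "y \<noteq> x" for y
    using that h1[of y] by (auto simp: C_def f_def)
  moreover have "f y = 0" if "y \<notin> U" for y
    using that h1[of y] by (auto simp: C_def f_def)
  moreover have "f x = 1"
    using x h(2) by (simp add: f_def)
  ultimately show ?thesis using that by blast
qed

lemma bump_function_topspace:
  assumes "x \<in> topspace X" "finite F"
  obtains f where "f \<in> S" "f x = 1" "\<And>y. y \<in> F \<Longrightarrow> y \<noteq> x \<Longrightarrow> f y = 0"
  using bump_function[OF openin_topspace assms] by metis


section \<open>The dual space consists of the combinations of point evaluations\<close>

definition supp :: "('a \<Rightarrow> 'k) \<Rightarrow> 'a set" where
  "supp a = {x. a x \<noteq> 0}"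

definition combination :: "('a \<Rightarrow> 'k) \<Rightarrow> ('a \<Rightarrow> 'k) \<Rightarrow> 'k" where
  "combination a = (\<lambda>f. if f \<in> S then \<Sum>x\<in>supp a. a x * f x else 0)"

lemma combination_eq_sum:
  assumes "finite F" "supp a \<subseteq> F" "f \<in> S"
  shows "combination a f = (\<Sum>x\<in>F. a x * f x)"
  unfolding combination_def using assms
  by (auto simp: supp_def intro!: sum.mono_neutral_left)

lemma combination_in_dual:
  assumes "finite (supp a)"
  shows "combination a \<in> dual"
proof -
  have "continuous_map space euclidean (\<lambda>f. \<Sum>x\<in>supp a. a x * f x)"
    using assms by (intro continuous_map_sum continuous_map_mult_left continuous_map_eval)
  then have "continuous_map space euclidean (combination a)"
    by (rule continuous_map_eq) (simp add: combination_def)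
  moreover have "combination a (f + g) = combination a f + combination a g"
    if "f \<in> S" "g \<in> S" for f g
    using that add_in[OF that] by (simp add: combination_def distrib_left sum.distrib)
  moreover have "combination a (fun_scale c f) = c * combination a f" if "f \<in> S" for c f
    using that scale_in[OF that, of c]
    by (simp add: combination_def) (simp add: fun_scale_def sum_distrib_left mult_ac)
  ultimately show ?thesis
    by (simp add: dual_space_def functions_on_def) (simp add: combination_def)
qed

lemma dual_diff:
  assumes "\<xi> \<in> dual" "f \<in> S" "g \<in> S"
  shows "\<xi> (f + fun_scale (-1) g) = \<xi> f - \<xi> g"
  using assms by (simp add: dual_space_def scale_in)

lemma dual_sum:
  assumes "\<xi> \<in> dual" "\<And>x. x \<in> F \<Longrightarrow> f x \<in> S"
  shows "\<xi> (\<Sum>x\<in>F. f x) = (\<Sum>x\<in>F. \<xi> (f x))"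
proof -
  have "\<xi> (fun_scale 0 0) = 0 * \<xi> 0"
    using assms(1) zero_in by (simp add: dual_space_def)
  then have "\<xi> 0 = 0"
    by (simp add: fun_scale_def zero_fun_def)
  with assms show ?thesis
    by (induction F rule: infinite_finite_induct) (auto simp: dual_space_def sum_in)
qed

text \<open>
  Continuity at \<open>0\<close> bounds \<open>\<xi>\<close> by \<open>1\<close> on a neighbourhood that restricts only finitely many
  coordinates. The functions that vanish at those coordinates form a vector space inside this
  neighbourhood, and a linear functional bounded on a vector space is zero there.
\<close>

lemma dual_vanishes_off_finite:
  assumes \<xi>: "\<xi> \<in> dual"
  obtains F where "finite F" "\<And>f. f \<in> S \<Longrightarrow> (\<And>x. x \<in> F \<Longrightarrow> f x = 0) \<Longrightarrow> \<xi> f = 0"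
proof -
  have lin: "\<xi> (fun_scale c f) = c * \<xi> f" if "f \<in> S" for c f
    using \<xi> that by (simp add: dual_space_def)
  have "continuous_map space euclidean \<xi>"
    using \<xi> by (simp add: dual_space_def)
  then have "openin space {f \<in> topspace space. \<xi> f \<in> ball 0 1}"
    by (rule openin_continuous_map_preimage) simp
  then obtain W where W: "openin (product_topology (\<lambda>_. euclidean) UNIV) W"
      "{f \<in> S. \<xi> f \<in> ball 0 1} = W \<inter> S"
    by (auto simp: pointwise_topology_def openin_subtopology)
  have "fun_scale 0 0 = (0 :: 'a \<Rightarrow> 'k)"
    by (simp add: fun_scale_def zero_fun_def)
  then have "\<xi> 0 = 0"
    using lin[OF zero_in, of 0] by simp
  then have "0 \<in> {f \<in> S. \<xi> f \<in> ball 0 1}"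
    using zero_in by simp
  then have "0 \<in> W"
    unfolding W(2) by blast
  moreover have "\<forall>w\<in>W. \<exists>U. finite {x. U x \<noteq> UNIV} \<and> w \<in> Pi\<^sub>E UNIV U \<and> Pi\<^sub>E UNIV U \<subseteq> W"
    using W(1) unfolding openin_product_topology_alt topspace_euclidean by simp metis
  ultimately obtain U where U: "finite {x. U x \<noteq> UNIV}" "0 \<in> Pi\<^sub>E UNIV U" "Pi\<^sub>E UNIV U \<subseteq> W"
    by blast
  show ?thesis
  proof (rule that[OF U(1)])
    fix f assume f: "f \<in> S" "\<And>x. x \<in> {x. U x \<noteq> UNIV} \<Longrightarrow> f x = 0"
    have small: "norm (c * \<xi> f) < 1" for c
    proof -
      have "fun_scale c f x \<in> U x" for x
        using f(2)[of x] U(2) by (cases "U x = UNIV") (auto simp: fun_scale_def zero_fun_def)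
      then have "fun_scale c f \<in> W"
        using U(3) by auto
      then have "\<xi> (fun_scale c f) \<in> ball 0 1"
        using W(2) scale_in[OF f(1)] by blast
      then show ?thesis using lin[OF f(1)] by simp
    qed
    show "\<xi> f = 0"
      using small[of "1 / \<xi> f"] by (cases "\<xi> f = 0") auto
  qed
qed

text \<open>
  On the coordinates \<open>F\<close> that determine \<open>\<xi>\<close>, every function agrees with a linear combination of bump
  functions, one for each point of \<open>F\<close>; the value of \<open>\<xi>\<close> at such a bump function is the coefficient.
\<close>

lemma dual_is_combination:
  assumes \<xi>: "\<xi> \<in> dual"
  obtains a where "finite (supp a)" "supp a \<subseteq> topspace X" "\<xi> = combination a"
proof -
  obtain F0 where F0: "finite F0" "\<And>f. f \<in> S \<Longrightarrow> (\<And>x. x \<in> F0 \<Longrightarrow> f x = 0) \<Longrightarrow> \<xi> f = 0"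
    using dual_vanishes_off_finite[OF \<xi>] by blast
  define F where "F = F0 \<inter> topspace X"
  have F: "finite F" "F \<subseteq> topspace X"
    using F0(1) by (auto simp: F_def)
  have vanish: "\<xi> f = 0" if "f \<in> S" "\<And>x. x \<in> F \<Longrightarrow> f x = 0" for f
    using that outside by (intro F0(2)) (auto simp: F_def functions_on_def)
  have "\<exists>e. e \<in> S \<and> e x = 1 \<and> (\<forall>y\<in>F. y \<noteq> x \<longrightarrow> e y = 0)" if "x \<in> F" for x
  proof -
    have "x \<in> topspace X"
      using that F(2) by blast
    then obtain e where "e \<in> S" "e x = 1" "\<And>y. y \<in> F \<Longrightarrow> y \<noteq> x \<Longrightarrow> e y = 0"
      using bump_function_topspace F(1) by metis
    then show ?thesis by blast
  qed
  then obtain e where e: "\<And>x. x \<in> F \<Longrightarrow> e x \<in> S" "\<And>x. x \<in> F \<Longrightarrow> e x x = 1"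
      "\<And>x y. x \<in> F \<Longrightarrow> y \<in> F \<Longrightarrow> y \<noteq> x \<Longrightarrow> e x y = 0"
    by metis
  define a where "a = (\<lambda>x. if x \<in> F then \<xi> (e x) else 0)"
  have supp: "supp a \<subseteq> F"
    by (auto simp: supp_def a_def)
  have "\<xi> f = combination a f" for f
  proof (cases "f \<in> S")
    case True
    \<comment> \<open>The interpolation of \<open>f\<close> on \<open>F\<close> by bump functions.\<close>
    define g where "g = (\<Sum>x\<in>F. fun_scale (f x) (e x))"
    have g: "g \<in> S"
      unfolding g_def by (intro sum_in scale_in e)
    have "g y = f y" if "y \<in> F" for y
    proof -
      have "g y = (\<Sum>x\<in>F. if x = y then f x else 0)"
        unfolding g_def sum_fun_apply fun_scale_def using that e by (intro sum.cong) auto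
      with that F(1) show ?thesis by simp
    qed
    then have "\<xi> (f + fun_scale (-1) g) = 0"
      using True g by (intro vanish add_in scale_in) (auto simp: fun_scale_def)
    then have "\<xi> f = \<xi> g"
      using dual_diff[OF \<xi> True g] by simp
    also have "\<dots> = (\<Sum>x\<in>F. \<xi> (fun_scale (f x) (e x)))"
      unfolding g_def by (intro dual_sum[OF \<xi>] scale_in e)
    also have "\<dots> = (\<Sum>x\<in>F. a x * f x)"
      using \<xi> e(1) by (intro sum.cong) (auto simp: a_def dual_space_def)
    also have "\<dots> = combination a f"
      using combination_eq_sum[OF F(1) supp True] ..
    finally show ?thesis .
  next
    case False
    with \<xi> show ?thesis by (simp add: dual_space_def functions_on_def combination_def)
  qed
  then show ?thesis
    using that[of a] supp F finite_subset by blast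
qed


section \<open>The strong dual and its weak topology\<close>

lemma topspace_strong: "topspace strong = dual"
proof
  show "topspace strong \<subseteq> dual"
    using openin_strong_dual[of fun_scale space "topspace strong"] by simp
  have "tvs_bounded fun_scale space {}"
    unfolding tvs_bounded_def by (auto intro: exI[of _ 1])
  then have "openin strong dual"
    unfolding openin_strong_dual by (blast intro: zero_less_one)
  then show "dual \<subseteq> topspace strong"
    by (rule openin_subset)
qed

lemma topspace_weak: "topspace (weak_topology fun_scale strong) = dual"
proof -
  have "(\<lambda>_. 0) \<in> dual_space fun_scale strong"
    by (simp add: dual_space_def functions_on_def)
  then have "{\<xi> \<in> topspace strong. (\<lambda>_. 0) \<xi> \<in> (UNIV::'k set)} \<in>
      {{\<xi> \<in> topspace strong. \<Xi> \<xi> \<in> U} |\<Xi> U. \<Xi> \<in> dual_space fun_scale strong \<and> open U}"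
    by blast
  then have "topspace strong \<subseteq> topspace (weak_topology fun_scale strong)"
    unfolding weak_topology_def topology_generated_by_topspace by blast
  moreover have "topspace (weak_topology fun_scale strong) \<subseteq> topspace strong"
    unfolding weak_topology_def topology_generated_by_topspace by blast
  ultimately show ?thesis by (simp add: topspace_strong)
qed

lemma bounded_singleton:
  assumes f: "f \<in> S"
  shows "tvs_bounded fun_scale space {f}"
  unfolding tvs_bounded_def
proof (intro conjI allI impI)
  fix V assume V: "openin space V \<and> 0 \<in> V"
  have "continuous_map euclidean euclidean (\<lambda>c::'k. fun_scale c f x)" for x
    by (simp add: fun_scale_def continuous_on_mult_right)
  then have "continuous_map euclidean space (\<lambda>c. fun_scale c f)"
    unfolding pointwise_topology_def continuous_map_in_subtopology
    using scale_in[OF f] by (auto simp: continuous_map_componentwise_UNIV)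
  then have "openin euclidean {c \<in> topspace euclidean. fun_scale c f \<in> V}"
    using V by (intro openin_continuous_map_preimage) auto
  then have "open {c. fun_scale c f \<in> V}"
    by simp
  moreover have "0 \<in> {c. fun_scale c f \<in> V}"
    using V by (simp add: fun_scale_def zero_fun_def)
  ultimately obtain e where e: "e > 0" "ball 0 e \<subseteq> {c. fun_scale c f \<in> V}"
    by (meson openE)
  have "{f} \<subseteq> fun_scale c ` V" if c: "norm c \<ge> 2 / e" for c
  proof -
    have "norm c > 0"
      using c e(1) by (meson divide_pos_pos less_le_trans zero_less_numeral)
    moreover have "norm (inverse c) < e"
    proof -
      have "1 < e * norm c"
        using c e(1) by (simp add: field_simps)
      then show ?thesis
        using \<open>norm c > 0\<close> by (simp add: norm_divide inverse_eq_divide divide_less_eq)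
    qed
    ultimately have "fun_scale (inverse c) f \<in> V" "fun_scale c (fun_scale (inverse c) f) = f"
      using e(2) by (auto simp: fun_scale_def fun_eq_iff)
    then show ?thesis
      by (metis empty_subsetI image_eqI insert_subset)
  qed
  then show "\<exists>t>0. \<forall>c. norm c \<ge> t \<longrightarrow> {f} \<subseteq> fun_scale c ` V"
    using e(1) by (intro exI[of _ "2 / e"]) auto
qed (use f in simp)

lemma dual_add:
  assumes "\<xi> \<in> dual" "\<eta> \<in> dual"
  shows "\<xi> + \<eta> \<in> dual"
proof -
  have "continuous_map space euclidean (\<lambda>f. \<xi> f + \<eta> f)"
    using assms by (intro continuous_map_add) (auto simp: dual_space_def)
  with assms show ?thesis
    by (auto simp: dual_space_def functions_on_def plus_fun_def algebra_simps)
qed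

lemma dual_scale:
  assumes "\<xi> \<in> dual"
  shows "fun_scale c \<xi> \<in> dual"
proof -
  have "continuous_map space euclidean (\<lambda>f. c * \<xi> f)"
    using assms by (intro continuous_map_mult_left) (auto simp: dual_space_def)
  with assms show ?thesis
    by (auto simp: dual_space_def functions_on_def fun_scale_def algebra_simps)
qed

text \<open>
  Points of \<open>S\<close> act on the dual, and continuously so because a single function is a bounded set.
  These evaluations separate the functionals.
\<close>

lemma eval_in_bidual:
  assumes f: "f \<in> S"
  shows "(\<lambda>\<xi>. if \<xi> \<in> dual then \<xi> f else 0) \<in> dual_space fun_scale strong"
proof -
  have "openin strong {\<xi> \<in> dual. \<xi> f \<in> V}" if V: "open V" for V
    unfolding openin_strong_dual
  proof (intro conjI ballI)
    fix \<xi> assume "\<xi> \<in> {\<xi> \<in> dual. \<xi> f \<in> V}"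
    then obtain e where "e > 0" "ball (\<xi> f) e \<subseteq> V"
      using V by (auto elim: openE)
    then have "{\<eta> \<in> dual. \<forall>x\<in>{f}. norm (\<eta> x - \<xi> x) < e} \<subseteq> {\<xi> \<in> dual. \<xi> f \<in> V}"
      by (auto simp: dist_norm norm_minus_commute)
    with bounded_singleton[OF f] \<open>e > 0\<close>
    show "\<exists>A \<epsilon>. tvs_bounded fun_scale space A \<and> \<epsilon> > 0 \<and>
        {\<eta> \<in> dual. \<forall>x\<in>A. norm (\<eta> x - \<xi> x) < \<epsilon>} \<subseteq> {\<xi> \<in> dual. \<xi> f \<in> V}"
      by blast
  qed auto
  then have "continuous_map strong euclidean (\<lambda>\<xi>. \<xi> f)"
    by (auto simp: continuous_map_def topspace_strong)
  then have "continuous_map strong euclidean (\<lambda>\<xi>. if \<xi> \<in> dual then \<xi> f else 0)"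
    by (rule continuous_map_eq) (simp add: topspace_strong)
  then show ?thesis
    by (auto simp: dual_space_def[of fun_scale strong] topspace_strong functions_on_def
        dual_add dual_scale) (simp add: fun_scale_def)
qed

lemma Hausdorff_weak: "Hausdorff_space (weak_topology fun_scale strong)"
  unfolding Hausdorff_space_def topspace_weak
proof (intro allI impI, elim conjE)
  fix \<xi> \<eta> assume "\<xi> \<in> dual" "\<eta> \<in> dual" "\<xi> \<noteq> \<eta>"
  then obtain f where "\<xi> f \<noteq> \<eta> f" by blast
  moreover have "\<zeta> f = 0" if "\<zeta> \<in> dual" "f \<notin> S" for \<zeta>
    using that by (simp add: dual_space_def functions_on_def)
  ultimately have f: "f \<in> S"
    using \<open>\<xi> \<in> dual\<close> \<open>\<eta> \<in> dual\<close> by metis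
  obtain U V where UV: "open U" "open V" "\<xi> f \<in> U" "\<eta> f \<in> V" "U \<inter> V = {}"
    using hausdorff[OF \<open>\<xi> f \<noteq> \<eta> f\<close>] by blast
  define N where "N = (\<lambda>W. {\<zeta> \<in> topspace strong. (if \<zeta> \<in> dual then \<zeta> f else 0) \<in> W})"
  have "openin (weak_topology fun_scale strong) (N W)" if "open W" for W
    unfolding weak_topology_def N_def
    using eval_in_bidual[OF f] that
    by (intro topology_generated_by_Basis CollectI
        exI[of _ "\<lambda>\<zeta>. if \<zeta> \<in> dual then \<zeta> f else 0"] exI[of _ W]) simp
  moreover have "\<xi> \<in> N U" "\<eta> \<in> N V" "disjnt (N U) (N V)"
    using UV \<open>\<xi> \<in> dual\<close> \<open>\<eta> \<in> dual\<close> by (auto simp: N_def topspace_strong disjnt_def)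
  ultimately show "\<exists>U V. openin (weak_topology fun_scale strong) U \<and>
      openin (weak_topology fun_scale strong) V \<and> \<xi> \<in> U \<and> \<eta> \<in> V \<and> disjnt U V"
    using UV(1,2) by blast
qed


section \<open>Combinations over a fixed finite set\<close>

definition coefficients :: "'a set \<Rightarrow> ('a \<Rightarrow> 'k) topology" where
  "coefficients F = subtopology (product_topology (\<lambda>_. euclidean) UNIV) {a. supp a \<subseteq> F}"

lemma topspace_coefficients [simp]: "topspace (coefficients F) = {a. supp a \<subseteq> F}"
  by (simp add: coefficients_def)

lemma limitin_coefficients:
  "limitin (coefficients F) a b \<F> \<longleftrightarrow>
     supp b \<subseteq> F \<and> eventually (\<lambda>n. supp (a n) \<subseteq> F) \<F> \<and> (\<forall>x. ((\<lambda>n. a n x) \<longlongrightarrow> b x) \<F>)"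
  by (simp add: coefficients_def limitin_subtopology limitin_componentwise)

text \<open>
  By linearity, a functional takes on such a combination the sum of the coefficients weighted by its
  values at the point evaluations, and this finite sum depends continuously on the coefficients.
\<close>

lemma continuous_map_combination:
  assumes F: "finite F"
  shows "continuous_map (coefficients F) (weak_topology fun_scale strong) combination"
proof -
  define \<delta> :: "'a \<Rightarrow> 'a \<Rightarrow> 'k" where "\<delta> = (\<lambda>x y. if y = x then 1 else 0)"
  have dual: "combination a \<in> dual" if "supp a \<subseteq> F" for a
    using F that by (meson combination_in_dual finite_subset)
  have expand: "\<Xi> (combination a) = (\<Sum>x\<in>F. a x * \<Xi> (combination (\<delta> x)))"
    if \<Xi>: "\<Xi> \<in> dual_space fun_scale strong" and a: "supp a \<subseteq> F" for \<Xi> a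
  proof -
    have \<delta>: "combination (\<delta> x) \<in> dual" for x
      by (intro combination_in_dual) (auto simp: supp_def \<delta>_def)
    have \<delta>_eval: "combination (\<delta> x) f = f x" if "f \<in> S" for x f
      using combination_eq_sum[of "{x}" "\<delta> x" f] that by (auto simp: supp_def \<delta>_def)
    have zero: "0 \<in> dual" using combination_in_dual[of "\<lambda>_. 0"]
      by (simp add: supp_def combination_def[abs_def] zero_fun_def if_distrib cong: if_cong)
    have "\<Xi> (fun_scale 0 0) = 0 * \<Xi> 0"
      using \<Xi> zero unfolding dual_space_def[of fun_scale strong] topspace_strong by blast
    then have \<Xi>0: "\<Xi> 0 = 0"
      by (simp add: fun_scale_def zero_fun_def)
    have \<Xi>_sum: "(\<Sum>x\<in>G. fun_scale (a x) (combination (\<delta> x))) \<in> dual \<and>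
        \<Xi> (\<Sum>x\<in>G. fun_scale (a x) (combination (\<delta> x))) = (\<Sum>x\<in>G. a x * \<Xi> (combination (\<delta> x)))"
      if "finite G" for G
      using that
    proof (induction G rule: finite_induct)
      case empty
      show ?case using zero \<Xi>0 by (simp only: sum.empty simp_thms)
    next
      case (insert y G)
      have lin: "\<Xi> (\<xi> + \<eta>) = \<Xi> \<xi> + \<Xi> \<eta>" "\<Xi> (fun_scale c \<xi>) = c * \<Xi> \<xi>"
        if "\<xi> \<in> dual" "\<eta> \<in> dual" for \<xi> \<eta> c
        using \<Xi> that unfolding dual_space_def[of fun_scale strong] topspace_strong by blast+
      have "fun_scale (a y) (combination (\<delta> y)) \<in> dual"
        by (intro dual_scale \<delta>)
      then show ?case
        using insert.IH by (simp only: sum.insert[OF insert.hyps] dual_add lin \<delta> simp_thms)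
    qed
    have "combination a = (\<Sum>x\<in>F. fun_scale (a x) (combination (\<delta> x)))"
    proof
      fix f
      show "combination a f = (\<Sum>x\<in>F. fun_scale (a x) (combination (\<delta> x))) f"
      proof (cases "f \<in> S")
        case True
        then show ?thesis
          using combination_eq_sum[OF F a] by (simp add: sum_fun_apply fun_scale_def \<delta>_eval)
      next
        case False
        then show ?thesis by (simp add: combination_def sum_fun_apply fun_scale_def)
      qed
    qed
    with \<Xi>_sum[OF F] show ?thesis by simp
  qed
  show ?thesis
    unfolding weak_topology_def
  proof (rule continuous_on_generated_topo)
    fix V assume "V \<in> {{\<xi> \<in> topspace strong. \<Xi> \<xi> \<in> U} |\<Xi> U.
        \<Xi> \<in> dual_space fun_scale strong \<and> open U}"
    then obtain \<Xi> U where \<Xi>: "\<Xi> \<in> dual_space fun_scale strong" and U: "open U"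
      and V: "V = {\<xi> \<in> dual. \<Xi> \<xi> \<in> U}"
      by (auto simp: topspace_strong)
    have "continuous_map (coefficients F) euclidean
        (\<lambda>a. \<Sum>x\<in>F. a x * \<Xi> (combination (\<delta> x)))"
      unfolding coefficients_def using F
      by (intro continuous_map_sum continuous_map_mult_right continuous_map_from_subtopology
          continuous_map_product_projection) auto
    then have "openin (coefficients F) {a \<in> topspace (coefficients F).
        (\<Sum>x\<in>F. a x * \<Xi> (combination (\<delta> x))) \<in> U}"
      using U by (intro openin_continuous_map_preimage) auto
    also have "{a \<in> topspace (coefficients F). (\<Sum>x\<in>F. a x * \<Xi> (combination (\<delta> x))) \<in> U} =
        combination -` V \<inter> topspace (coefficients F)"
      using expand[OF \<Xi>] dual by (auto simp: V)
    finally show "openin (coefficients F) (combination -` V \<inter> topspace (coefficients F))" .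
  next
    have "combination ` topspace (coefficients F) \<subseteq> topspace (weak_topology fun_scale strong)"
      using dual by (auto simp: topspace_weak)
    then show "combination ` topspace (coefficients F) \<subseteq>
        \<Union> {{\<xi> \<in> topspace strong. \<Xi> \<xi> \<in> U} |\<Xi> U. \<Xi> \<in> dual_space fun_scale strong \<and> open U}"
      unfolding weak_topology_def topology_generated_by_topspace .
  qed
qed

definition polydisc :: "'a set \<Rightarrow> ('a \<Rightarrow> real) \<Rightarrow> ('a \<Rightarrow> 'k) set" where
  "polydisc F M = {a. supp a \<subseteq> F \<and> (\<forall>x\<in>F. norm (a x) \<le> M x)}"

lemma compactin_polydisc: "compactin (coefficients F) (polydisc F M)"
proof -
  have "polydisc F M = Pi\<^sub>E UNIV (\<lambda>x. if x \<in> F then cball 0 (M x) else {0})"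
    by (auto simp: polydisc_def supp_def PiE_iff split: if_splits)
  moreover have "compactin (product_topology (\<lambda>_. euclidean) UNIV)
      (Pi\<^sub>E UNIV (\<lambda>x. if x \<in> F then cball (0::'k) (M x) else {0}))"
    by (auto simp: compactin_PiE)
  ultimately show ?thesis
    by (auto simp: coefficients_def compactin_subtopology polydisc_def)
qed

lemma polydisc_combinations_in_dual:
  assumes "finite F"
  shows "combination ` polydisc F M \<subseteq> dual"
  using assms by (auto simp: polydisc_def intro!: combination_in_dual intro: finite_subset)

text \<open>
  The image of the polydisc is weakly compact and, the weak topology being Hausdorff, closed. So it
  contains the closure of each of its subsets.
\<close>

lemma relatively_weakly_compact_polydisc:
  assumes F: "finite F" and B: "B \<subseteq> combination ` polydisc F M"
  shows "relatively_weakly_compact fun_scale strong B"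
proof -
  let ?K = "combination ` polydisc F M"
  have K: "compactin (weak_topology fun_scale strong) ?K"
    using compactin_polydisc continuous_map_combination[OF F] by (rule image_compactin)
  then have "closedin (weak_topology fun_scale strong) ?K"
    using Hausdorff_weak by (simp add: compactin_imp_closedin)
  with B have "weak_topology fun_scale strong closure_of B \<subseteq> ?K"
    by (rule closure_of_minimal)
  with K have "compactin (weak_topology fun_scale strong) (weak_topology fun_scale strong closure_of B)"
    by (rule closed_compactin) simp
  then show ?thesis
    using B polydisc_combinations_in_dual[OF F]
    by (auto simp: relatively_weakly_compact_def topspace_strong)
qed

lemma polydisc_subsequence:
  assumes F: "finite F" and \<xi>: "range \<xi> \<subseteq> combination ` polydisc F M"
  obtains a :: "nat \<Rightarrow> 'a \<Rightarrow> 'k" and \<phi> b where "strict_mono \<phi>" "\<And>n. \<xi> n = combination (a n)"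
    "\<And>n. supp (a n) \<subseteq> F" "supp b \<subseteq> F" "\<And>x. (\<lambda>n. a (\<phi> n) x) \<longlonglongrightarrow> b x"
proof -
  have "\<xi> n \<in> combination ` polydisc F M" for n
    using \<xi> by (rule range_subsetD)
  then have "\<forall>n. \<exists>a. a \<in> polydisc F M \<and> \<xi> n = combination a"
    by (simp add: image_iff Bex_def)
  then obtain a where a: "\<And>n. a n \<in> polydisc F M" "\<And>n. \<xi> n = combination (a n)"
    by metis
  then obtain \<phi> b where "strict_mono \<phi>" and b: "\<And>x. x \<in> F \<Longrightarrow> (\<lambda>n. a (\<phi> n) x) \<longlonglongrightarrow> b x"
    using bounded_coordinates_convergent_subseq[OF F, of a M] by (auto simp: polydisc_def) metis
  have supp: "supp (a n) \<subseteq> F" for n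
    using a(1) by (auto simp: polydisc_def)
  then have a0: "a n x = 0" if "x \<notin> F" for n x
    using that by (auto simp: supp_def)
  show ?thesis
  proof (rule that[of \<phi> a "\<lambda>x. if x \<in> F then b x else 0"])
    show "(\<lambda>n. a (\<phi> n) x) \<longlonglongrightarrow> (if x \<in> F then b x else 0)" for x
      using b a0 by auto
  qed (use a supp \<open>strict_mono \<phi>\<close> in \<open>auto simp: supp_def\<close>)
qed

lemma relatively_weakly_seq_compact_polydisc:
  assumes F: "finite F" and B: "B \<subseteq> combination ` polydisc F M"
  shows "relatively_weakly_seq_compact fun_scale strong B"
  unfolding relatively_weakly_seq_compact_def
proof (intro conjI allI impI)
  show "B \<subseteq> topspace strong"
    using B polydisc_combinations_in_dual[OF F] by (auto simp: topspace_strong)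
  fix \<xi> :: "nat \<Rightarrow> _" assume "range \<xi> \<subseteq> B"
  with B have "range \<xi> \<subseteq> combination ` polydisc F M" by blast
  then obtain a \<phi> b where \<phi>: "strict_mono \<phi>" and \<xi>: "\<And>n. \<xi> n = combination (a n)"
    and supp: "\<And>n. supp (a n) \<subseteq> F" "supp b \<subseteq> F" and b: "\<And>x. (\<lambda>n. a (\<phi> n) x) \<longlonglongrightarrow> b x"
    using polydisc_subsequence[OF F] by metis
  have "limitin (coefficients F) (\<lambda>n. a (\<phi> n)) b sequentially"
    using supp b by (simp add: limitin_coefficients)
  then have "limitin (weak_topology fun_scale strong) (combination \<circ> (\<lambda>n. a (\<phi> n)))
      (combination b) sequentially"
    by (rule continuous_map_limit[OF continuous_map_combination[OF F]])
  moreover have "combination \<circ> (\<lambda>n. a (\<phi> n)) = \<xi> \<circ> \<phi>"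
    by (simp add: \<xi> fun_eq_iff)
  moreover have "combination b \<in> topspace strong"
    using F supp(2) by (auto simp: topspace_strong intro: combination_in_dual finite_subset)
  ultimately show "\<exists>\<phi> l. strict_mono \<phi> \<and> l \<in> topspace strong \<and>
      limitin (weak_topology fun_scale strong) (\<xi> \<circ> \<phi>) l sequentially"
    using \<phi> by auto
qed

lemma weakly_seq_precompact_polydisc:
  assumes F: "finite F" and B: "B \<subseteq> combination ` polydisc F M"
  shows "weakly_seq_precompact fun_scale strong B"
  unfolding weakly_seq_precompact_def
proof (intro conjI allI impI)
  show "B \<subseteq> topspace strong"
    using B polydisc_combinations_in_dual[OF F] by (auto simp: topspace_strong)
  fix \<xi> :: "nat \<Rightarrow> _" assume "range \<xi> \<subseteq> B"
  with B have "range \<xi> \<subseteq> combination ` polydisc F M" by blast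
  then obtain a \<phi> b where \<phi>: "strict_mono \<phi>" and \<xi>: "\<And>n. \<xi> n = combination (a n)"
    and supp: "\<And>n. supp (a n) \<subseteq> F" "supp b \<subseteq> F" and b: "\<And>x. (\<lambda>n. a (\<phi> n) x) \<longlonglongrightarrow> b x"
    using polydisc_subsequence[OF F] by metis
  have diff_supp: "supp (a m - a n) \<subseteq> F" for m n
    using supp(1)[of m] supp(1)[of n] by (force simp: supp_def)
  have diff: "combination (a m - a n) = \<xi> m - \<xi> n" for m n
  proof
    fix f
    show "combination (a m - a n) f = (\<xi> m - \<xi> n) f"
    proof (cases "f \<in> S")
      case True
      then show ?thesis
        using combination_eq_sum[OF F diff_supp True] combination_eq_sum[OF F supp(1) True]
        by (simp add: \<xi> left_diff_distrib sum_subtractf)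
    next
      case False
      then show ?thesis by (simp add: \<xi> combination_def)
    qed
  qed
  \<comment> \<open>A weak Cauchy sequence is one whose differences converge to \<open>0\<close> along pairs of indices.\<close>
  have "((\<lambda>z. a (\<phi> (fst z)) x - a (\<phi> (snd z)) x) \<longlongrightarrow> b x - b x)
      (sequentially \<times>\<^sub>F sequentially)" for x
    by (intro tendsto_diff filterlim_compose[OF b] filterlim_fst filterlim_snd)
  then have "limitin (coefficients F) (\<lambda>(m, n). a (\<phi> m) - a (\<phi> n)) 0
      (sequentially \<times>\<^sub>F sequentially)"
    using diff_supp by (simp add: limitin_coefficients split_beta supp_def)
  then have lim: "limitin (weak_topology fun_scale strong)
      (combination \<circ> (\<lambda>(m, n). a (\<phi> m) - a (\<phi> n))) (combination 0) (sequentially \<times>\<^sub>F sequentially)"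
    by (rule continuous_map_limit[OF continuous_map_combination[OF F]])
  have "combination 0 = 0"
    by (simp add: combination_def fun_eq_iff)
  with lim have lim0: "limitin (weak_topology fun_scale strong)
      (\<lambda>z. \<xi> (\<phi> (fst z)) - \<xi> (\<phi> (snd z))) 0 (sequentially \<times>\<^sub>F sequentially)"
    by (simp add: o_def split_beta diff)
  have "weakly_Cauchy fun_scale strong (\<xi> \<circ> \<phi>)"
    unfolding weakly_Cauchy_def
  proof (intro allI impI)
    fix U assume "openin (weak_topology fun_scale strong) U \<and> 0 \<in> U"
    with lim0 have "eventually (\<lambda>z. \<xi> (\<phi> (fst z)) - \<xi> (\<phi> (snd z)) \<in> U) (sequentially \<times>\<^sub>F sequentially)"
      by (simp add: limitin_def)
    then show "\<exists>N. \<forall>m\<ge>N. \<forall>n\<ge>N. (\<xi> \<circ> \<phi>) m - (\<xi> \<circ> \<phi>) n \<in> U"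
      unfolding eventually_prod_sequentially by auto
  qed
  with \<phi> show "\<exists>\<phi>. strict_mono \<phi> \<and> weakly_Cauchy fun_scale strong (\<xi> \<circ> \<phi>)"
    by blast
qed


section \<open>Every \<open>(p,q)\<close>-\<open>(V)\<close> set is a bounded set of combinations over a finite set\<close>

text \<open>
  Each functional sees only finitely many points, hence only finitely many of the functions of a
  point-finite sequence. On such a sequence it takes only finitely many nonzero values.
\<close>

lemma point_finite_weakly_summable:
  assumes g: "\<And>n. g n \<in> S" and fin: "\<And>x. finite {n. g n x \<noteq> 0}"
  shows "weakly_p_summable p fun_scale space g"
  unfolding weakly_p_summable_def
proof (intro conjI ballI)
  fix \<xi> assume "\<xi> \<in> dual"
  then obtain a where a: "finite (supp a)" "\<xi> = combination a"
    using dual_is_combination by metis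
  have "{n. \<xi> (g n) \<noteq> 0} \<subseteq> (\<Union>x\<in>supp a. {n. g n x \<noteq> 0})"
    by (auto simp: a(2) combination_def g intro: sum.neutral elim!: sum.not_neutral_contains_not_neutral)
  then have "finite {n. \<xi> (g n) \<noteq> 0}"
    using a(1) fin by (auto intro: finite_subset)
  then show "lp_c0_seq p (\<lambda>n. \<xi> (g n))"
    by (rule lp_c0_seq_finite_support)
qed (use g in auto)

lemma pq_V_set_bdd:
  "pq_V_set p q s T B \<Longrightarrow> weakly_p_summable p s T x \<Longrightarrow> bdd_above ((\<lambda>\<xi>. norm (\<xi> (x n))) ` B)"
  by (simp add: pq_V_set_def)

lemma pq_V_set_sup:
  "pq_V_set p q s T B \<Longrightarrow> weakly_p_summable p s T x \<Longrightarrow> lp_c0_seq q (\<lambda>n. SUP \<xi>\<in>B. norm (\<xi> (x n)))"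
  by (simp add: pq_V_set_def)

text \<open>
  If the supports of the functionals in the set covered infinitely many points, disjoint open sets
  \<open>U\<^sub>n\<close> around some of them would carry functions \<open>g\<^sub>n\<close> normed by one of the functionals each.
  The \<open>g\<^sub>n\<close> are point-finite and hence weakly \<open>p\<close>-summable, but the suprema stay at least \<open>1\<close>.
\<close>

lemma pq_V_set_finite_supports:
  assumes V: "pq_V_set p q fun_scale space (combination ` A)" and "1 \<le> q"
    and A: "\<And>a. a \<in> A \<Longrightarrow> finite (supp a)" "\<And>a. a \<in> A \<Longrightarrow> supp a \<subseteq> topspace X"
  shows "finite (\<Union>a\<in>A. supp a)"
proof (rule ccontr)
  assume "infinite (\<Union>a\<in>A. supp a)"
  moreover have "(\<Union>a\<in>A. supp a) \<subseteq> topspace X"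
    using A(2) by blast
  ultimately obtain x U where U: "\<And>n::nat. openin X (U n)" "\<And>n. x n \<in> (\<Union>a\<in>A. supp a) \<inter> U n"
    and disj: "\<And>m n. m \<noteq> n \<Longrightarrow> U m \<inter> U n = {}"
    using regular_Hausdorff_disjoint_open_sequence[OF regular Hausdorff] by metis
  have "\<exists>a g. a \<in> A \<and> g \<in> S \<and> combination a g = 1 \<and> (\<forall>y. y \<notin> U n \<longrightarrow> g y = 0)" for n
  proof -
    obtain a where a: "a \<in> A" "x n \<in> supp a"
      using U(2) by blast
    obtain f where f: "f \<in> S" "f (x n) = 1" "\<And>y. y \<in> supp a \<Longrightarrow> y \<noteq> x n \<Longrightarrow> f y = 0"
        "\<And>y. y \<notin> U n \<Longrightarrow> f y = 0"
      using bump_function[OF U(1)[of n] _ A(1)[OF a(1)]] U(2)[of n] by blast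
    define g where "g = fun_scale (1 / a (x n)) f"
    have "g \<in> S"
      unfolding g_def by (rule scale_in[OF f(1)])
    moreover have "combination a g = (\<Sum>y\<in>supp a. if y = x n then 1 else 0)"
      unfolding combination_eq_sum[OF A(1)[OF a(1)] subset_refl \<open>g \<in> S\<close>]
      using f(2,3) a(2) by (intro sum.cong) (auto simp: g_def fun_scale_def supp_def)
    then have "combination a g = 1"
      using A(1)[OF a(1)] a(2) by simp
    ultimately show ?thesis
      using a(1) f(4) by (intro exI[of _ a] exI[of _ g]) (auto simp: g_def fun_scale_def)
  qed
  then obtain a g where a: "\<And>n. a n \<in> A" and g: "\<And>n. g n \<in> S" "\<And>n. combination (a n) (g n) = 1"
      "\<And>n y. y \<notin> U n \<Longrightarrow> g n y = 0"
    by metis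
  have "finite {n. g n y \<noteq> 0}" for y
  proof (cases "\<exists>m. g m y \<noteq> 0")
    case True
    then obtain m where "g m y \<noteq> 0" ..
    then have "{n. g n y \<noteq> 0} \<subseteq> {m}"
      using g(3) disj by (metis (mono_tags, lifting) IntI emptyE insertI1 mem_Collect_eq subsetI)
    then show ?thesis by (rule finite_subset) simp
  qed auto
  with g(1) have "weakly_p_summable p fun_scale space g"
    by (rule point_finite_weakly_summable)
  note bdd = pq_V_set_bdd[OF V this] and lp = pq_V_set_sup[OF V this]
  have "1 \<le> (SUP \<xi>\<in>combination ` A. norm (\<xi> (g n)))" for n
  proof (rule cSUP_upper2[OF bdd])
    show "combination (a n) \<in> combination ` A"
      using a by blast
  qed (simp add: g(2))
  then have "norm (SUP \<xi>\<in>combination ` A. norm (\<xi> (g n))) \<ge> 1" for n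
    by (metis abs_ge_self order_trans real_norm_def)
  from not_lp_c0_seq_if_norm_ge_1[OF \<open>1 \<le> q\<close> this] lp show False
    by (rule notE)
qed

text \<open>The test sequence \<open>f, 0, 0, \<dots>\<close> is weakly \<open>p\<close>-summable.\<close>

lemma pq_V_set_bounded_at:
  assumes V: "pq_V_set p q fun_scale space B" and f: "f \<in> S"
  shows "\<exists>M. \<forall>\<xi>\<in>B. norm (\<xi> f) \<le> M"
proof -
  define g :: "nat \<Rightarrow> 'a \<Rightarrow> 'k" where "g = (\<lambda>n. if n = 0 then f else 0)"
  have "{n. g n x \<noteq> 0} \<subseteq> {0}" for x
    by (auto simp: g_def)
  then have "finite {n. g n x \<noteq> 0}" for x
    by (rule finite_subset) simp
  then have "weakly_p_summable p fun_scale space g"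
    using f zero_in by (intro point_finite_weakly_summable) (auto simp: g_def)
  with V have "bdd_above ((\<lambda>\<xi>. norm (\<xi> (g 0))) ` B)"
    by (rule pq_V_set_bdd)
  then show ?thesis
    by (auto simp: bdd_above_def g_def)
qed

text \<open>
  Once all supports lie in a finite set \<open>F\<close>, a function with value \<open>1\<close> at \<open>x\<close> and \<open>0\<close> at the other points
  of \<open>F\<close> reads off the coefficient at \<open>x\<close>. So boundedness at this function bounds that coefficient.
\<close>

lemma pq_V_set_subset_polydisc:
  assumes V: "pq_V_set p q fun_scale space B" and "1 \<le> q"
  obtains F M where "finite F" "B \<subseteq> combination ` polydisc F M"
proof -
  define A where "A = {a. finite (supp a) \<and> supp a \<subseteq> topspace X \<and> combination a \<in> B}"
  define F where "F = (\<Union>a\<in>A. supp a)"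
  have "B \<subseteq> dual"
    using V by (simp add: pq_V_set_def)
  then have BA: "B = combination ` A"
  proof (intro equalityI subsetI)
    fix \<xi> assume "\<xi> \<in> B"
    then obtain a where "finite (supp a)" "supp a \<subseteq> topspace X" "\<xi> = combination a"
      using dual_is_combination \<open>B \<subseteq> dual\<close> by (metis subsetD)
    with \<open>\<xi> \<in> B\<close> show "\<xi> \<in> combination ` A"
      by (simp add: A_def)
  qed (auto simp: A_def)
  have F: "finite F"
    unfolding F_def using V \<open>1 \<le> q\<close> unfolding BA
    by (rule pq_V_set_finite_supports) (auto simp: A_def)
  have "\<exists>M. \<forall>a\<in>A. norm (a x) \<le> M" if "x \<in> F" for x
  proof -
    have "x \<in> topspace X"
      using that by (auto simp: F_def A_def)
    then obtain e where e: "e \<in> S" "e x = 1" "\<And>y. y \<in> F \<Longrightarrow> y \<noteq> x \<Longrightarrow> e y = 0"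
      using bump_function_topspace F by metis
    obtain M where M: "\<And>\<xi>. \<xi> \<in> B \<Longrightarrow> norm (\<xi> e) \<le> M"
      using pq_V_set_bounded_at[OF V e(1)] by blast
    have "norm (a x) \<le> M" if "a \<in> A" for a
    proof -
      have "combination a e = (\<Sum>y\<in>F. a y * e y)"
        using that by (intro combination_eq_sum[OF F _ e(1)]) (auto simp: F_def)
      also have "\<dots> = (\<Sum>y\<in>F. if y = x then a y else 0)"
        using e by (intro sum.cong) auto
      also have "\<dots> = a x"
        using F \<open>x \<in> F\<close> by simp
      finally show ?thesis
        using M[of "combination a"] that by (simp add: A_def)
    qed
    then show ?thesis by blast
  qed
  then obtain M where "\<And>x a. x \<in> F \<Longrightarrow> a \<in> A \<Longrightarrow> norm (a x) \<le> M x"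
    by metis
  then have "A \<subseteq> polydisc F M"
    by (auto simp: polydisc_def F_def)
  with F show ?thesis
    using that BA by blast
qed

lemma all_properties:
  assumes "1 \<le> q"
  shows "property_V p q fun_scale space \<and> property_EV p q fun_scale space \<and>
         property_sV p q fun_scale space \<and> property_sEV p q fun_scale space \<and>
         property_wsV p q fun_scale space \<and> property_wsEV p q fun_scale space"
proof -
  have "relatively_weakly_compact fun_scale strong B \<and>
      relatively_weakly_seq_compact fun_scale strong B \<and>
      weakly_seq_precompact fun_scale strong B"
    if "pq_V_set p q fun_scale space B" for B
  proof -
    obtain F M where "finite F" "B \<subseteq> combination ` polydisc F M"
      using pq_V_set_subset_polydisc[OF \<open>pq_V_set p q fun_scale space B\<close> assms] by blast
    then show ?thesis
      by (intro conjI relatively_weakly_compact_polydisc relatively_weakly_seq_compact_polydisc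
          weakly_seq_precompact_polydisc)
  qed
  then show ?thesis
    by (simp add: property_V_def property_EV_def property_sV_def property_sEV_def
        property_wsV_def property_wsEV_def pq_EV_set_def)
qed

end


section \<open>The Baire classes\<close>

lemma continuous_functions_add:
  "f \<in> continuous_functions X \<Longrightarrow> g \<in> continuous_functions X \<Longrightarrow> f + g \<in> continuous_functions X"
  by (auto simp: continuous_functions_def functions_on_def plus_fun_def intro: continuous_map_add)

lemma continuous_functions_scale:
  "f \<in> continuous_functions X \<Longrightarrow> fun_scale c f \<in> continuous_functions X"
  by (auto simp: continuous_functions_def functions_on_def fun_scale_def
      intro: continuous_map_mult_left)

lemma baire_class_zero:
  assumes "Well_order r" "underS r \<alpha> = {}"
  shows "baire_class X r \<alpha> = continuous_functions X"
  using assms(2) by (simp add: baire_class_unfold[OF assms(1), of X \<alpha>])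

lemma baire_class_limitI:
  assumes "Well_order r" and "f \<in> functions_on (topspace X)"
    and "\<And>n::nat. g n \<in> (\<Union>\<beta>\<in>underS r \<alpha>. baire_class X r \<beta>)"
    and "\<And>x. x \<in> topspace X \<Longrightarrow> (\<lambda>n. g n x) \<longlonglongrightarrow> f x"
  shows "f \<in> baire_class X r \<alpha>"
proof -
  have "underS r \<alpha> \<noteq> {}"
    using assms(3) by blast
  with assms(2-4) show ?thesis
    unfolding baire_class_unfold[OF assms(1), of X \<alpha>] by (simp only: if_False) blast
qed

lemma baire_class_limitE:
  assumes "Well_order r" "f \<in> baire_class X r \<alpha>" "underS r \<alpha> \<noteq> {}"
  obtains g where "\<And>n::nat. g n \<in> (\<Union>\<beta>\<in>underS r \<alpha>. baire_class X r \<beta>)"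
    and "\<And>x. x \<in> topspace X \<Longrightarrow> (\<lambda>n. g n x) \<longlonglongrightarrow> f x"
proof -
  from assms(2,3) have "\<exists>g. (\<forall>n::nat. g n \<in> (\<Union>\<beta>\<in>underS r \<alpha>. baire_class X r \<beta>)) \<and>
      (\<forall>x\<in>topspace X. (\<lambda>n. g n x) \<longlonglongrightarrow> f x)"
    unfolding baire_class_unfold[OF assms(1), of X \<alpha>] by (simp only: if_False mem_Collect_eq)
  with that show ?thesis by metis
qed

lemma baire_class_outside:
  assumes "Well_order r"
  shows "baire_class X r \<alpha> \<subseteq> functions_on (topspace X)"
  by (subst baire_class_unfold[OF assms]) (auto simp: continuous_functions_def)

lemma baire_class_mono:
  assumes r: "Well_order r" and \<beta>: "\<beta> \<in> underS r \<alpha>"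
  shows "baire_class X r \<beta> \<subseteq> baire_class X r \<alpha>"
proof
  fix f assume f: "f \<in> baire_class X r \<beta>"
  \<comment> \<open>The constant sequence \<open>f\<close> converges to \<open>f\<close>.\<close>
  show "f \<in> baire_class X r \<alpha>"
  proof (rule baire_class_limitI[OF r])
    show "f \<in> functions_on (topspace X)"
      using f baire_class_outside[OF r] by blast
    show "f \<in> (\<Union>\<beta>\<in>underS r \<alpha>. baire_class X r \<beta>)" for n :: nat
      using f \<beta> by blast
  qed simp
qed

lemma well_order_underS_induct [consumes 1, case_names less]:
  assumes "Well_order r" and "\<And>\<alpha>. (\<And>\<beta>. \<beta> \<in> underS r \<alpha> \<Longrightarrow> P \<beta>) \<Longrightarrow> P \<alpha>"
  shows "P \<alpha>"
proof -
  interpret wo_rel r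
    using assms(1) by (simp add: wo_rel_def)
  show ?thesis
  proof (rule well_order_induct)
    fix \<alpha> assume IH: "\<forall>\<beta>. \<beta> \<noteq> \<alpha> \<and> (\<beta>, \<alpha>) \<in> r \<longrightarrow> P \<beta>"
    show "P \<alpha>"
      by (rule assms(2)) (use IH in \<open>simp add: Order_Relation.underS_def\<close>)
  qed
qed

lemma continuous_in_baire_class:
  assumes r: "Well_order r"
  shows "continuous_functions X \<subseteq> baire_class X r \<alpha>"
  using r
proof (induction \<alpha> rule: well_order_underS_induct)
  case (less \<alpha>)
  show ?case
  proof (cases "underS r \<alpha> = {}")
    case True
    with r show ?thesis by (simp add: baire_class_zero)
  next
    case False
    then obtain \<beta> where "\<beta> \<in> underS r \<alpha>" by blast
    then show ?thesis
      using less baire_class_mono[OF r] by blast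
  qed
qed

text \<open>
  Two approximating sequences may use different classes at the same index; since the classes
  increase and the order is total, the larger of the two classes contains both terms.
\<close>

lemma baire_class_add:
  fixes f g :: "'a \<Rightarrow> 'k::real_normed_field"
  assumes r: "Well_order r"
    and "f \<in> baire_class X r \<alpha>" "g \<in> baire_class X r \<alpha>"
  shows "f + g \<in> baire_class X r \<alpha>"
  using assms
proof (induction \<alpha> arbitrary: f g rule: well_order_underS_induct)
  case (less \<alpha>)
  let ?L = "\<Union>\<beta>\<in>underS r \<alpha>. baire_class X r \<beta> :: ('a \<Rightarrow> 'k) set"
  show ?case
  proof (cases "underS r \<alpha> = {}")
    case True
    show ?thesis
      using less.prems unfolding baire_class_zero[OF r True] by (rule continuous_functions_add)
  next
    case False
    have add: "u + v \<in> ?L" if uv: "u \<in> ?L" "v \<in> ?L" for u v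
    proof -
      obtain \<beta> \<gamma> where \<beta>: "\<beta> \<in> underS r \<alpha>" "u \<in> baire_class X r \<beta>"
        and \<gamma>: "\<gamma> \<in> underS r \<alpha>" "v \<in> baire_class X r \<gamma>"
        using uv by blast
      have "\<beta> \<in> Field r" "\<gamma> \<in> Field r"
        using \<beta>(1) \<gamma>(1) by (auto simp: underS_def intro: FieldI1)
      then have "\<beta> = \<gamma> \<or> \<beta> \<in> underS r \<gamma> \<or> \<gamma> \<in> underS r \<beta>"
        using r by (auto simp: underS_def order_on_defs total_on_def)
      then obtain \<delta> where \<delta>: "\<delta> \<in> underS r \<alpha>" "u \<in> baire_class X r \<delta>" "v \<in> baire_class X r \<delta>"
        using \<beta> \<gamma> baire_class_mono[OF r] by blast
      then have "u + v \<in> baire_class X r \<delta>"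
        by (rule less.IH)
      with \<delta>(1) show ?thesis by blast
    qed
    obtain u where u: "\<And>n. u n \<in> ?L" "\<And>x. x \<in> topspace X \<Longrightarrow> (\<lambda>n. u n x) \<longlonglongrightarrow> f x"
      using baire_class_limitE[OF r less.prems(1) False] by blast
    obtain v where v: "\<And>n. v n \<in> ?L" "\<And>x. x \<in> topspace X \<Longrightarrow> (\<lambda>n. v n x) \<longlonglongrightarrow> g x"
      using baire_class_limitE[OF r less.prems(2) False] by blast
    show ?thesis
    proof (rule baire_class_limitI[OF r])
      have "f \<in> functions_on (topspace X)" "g \<in> functions_on (topspace X)"
        using less.prems baire_class_outside[OF r] by blast+
      then show "f + g \<in> functions_on (topspace X)"
        by (simp add: functions_on_def)
      show "u n + v n \<in> ?L" for n
        by (intro add u v)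
      show "(\<lambda>n. (u n + v n) x) \<longlonglongrightarrow> (f + g) x" if "x \<in> topspace X" for x
        using tendsto_add[OF u(2) v(2), OF that that] by simp
    qed
  qed
qed

lemma baire_class_scale:
  fixes f :: "'a \<Rightarrow> 'k::real_normed_field"
  assumes r: "Well_order r" and "f \<in> baire_class X r \<alpha>"
  shows "fun_scale c f \<in> baire_class X r \<alpha>"
  using assms
proof (induction \<alpha> arbitrary: f rule: well_order_underS_induct)
  case (less \<alpha>)
  let ?L = "\<Union>\<beta>\<in>underS r \<alpha>. baire_class X r \<beta> :: ('a \<Rightarrow> 'k) set"
  show ?case
  proof (cases "underS r \<alpha> = {}")
    case True
    show ?thesis
      using less.prems unfolding baire_class_zero[OF r True] by (rule continuous_functions_scale)
  next
    case False
    obtain u where u: "\<And>n. u n \<in> ?L" "\<And>x. x \<in> topspace X \<Longrightarrow> (\<lambda>n. u n x) \<longlonglongrightarrow> f x"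
      using baire_class_limitE[OF r less.prems False] by blast
    show ?thesis
    proof (rule baire_class_limitI[OF r])
      show "fun_scale c f \<in> functions_on (topspace X)"
        using less.prems baire_class_outside[OF r, of X \<alpha>]
        by (auto simp: functions_on_def fun_scale_def subset_iff)
      show "fun_scale c (u n) \<in> ?L" for n
        using u(1)[of n] less.IH by blast
      show "(\<lambda>n. fun_scale c (u n) x) \<longlonglongrightarrow> fun_scale c f x" if "x \<in> topspace X" for x
        using tendsto_mult_left[OF u(2)[OF that]] by (simp add: fun_scale_def)
    qed
  qed
qed


section \<open>The spaces of continuous functions and of Baire functions\<close>

lemma Cp_and_Baire_properties:
  fixes X :: "'a topology" and E :: "('a \<Rightarrow> 'k::{real_normed_field,heine_borel}) topology"
  assumes "1 \<le> q" and r: "Well_order r"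
    and X: "completely_regular_space X" "t1_space X"
    and E: "E \<in> {Cp_space X, baire_space X r \<alpha>}"
  shows "property_V p q fun_scale E \<and> property_EV p q fun_scale E \<and>
         property_sV p q fun_scale E \<and> property_sEV p q fun_scale E \<and>
         property_wsV p q fun_scale E \<and> property_wsEV p q fun_scale E"
proof -
  have "pointwise_function_space X (continuous_functions X :: ('a \<Rightarrow> 'k) set)"
    using X by unfold_locales
      (auto simp: continuous_functions_add continuous_functions_scale, auto simp: continuous_functions_def)
  moreover have "pointwise_function_space X (baire_class X r \<alpha> :: ('a \<Rightarrow> 'k) set)"
    using X by unfold_locales
      (use r in \<open>auto simp: baire_class_add baire_class_scale
        intro: subsetD[OF continuous_in_baire_class] subsetD[OF baire_class_outside]\<close>)
  moreover have "E = pointwise_topology (continuous_functions X) \<or>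
      E = pointwise_topology (baire_class X r \<alpha>)"
    using E by (simp add: Cp_space_def baire_space_def)
  ultimately obtain S where "pointwise_function_space X S" "E = pointwise_topology S"
    by metis
  then show ?thesis
    using pointwise_function_space.all_properties[of X S q p] \<open>1 \<le> q\<close> by simp
qed

theorem theorem10p10:
  fixes p q :: ereal and X :: "'a topology" and r :: "'o rel" and \<alpha> :: 'o
  assumes "1 \<le> p" and "p \<le> q"
    and "Well_order r" and "\<alpha> \<in> Field r" and "countable (underS r \<alpha>)"
    and "completely_regular_space X" and "t1_space X"
  shows "(\<forall>E \<in> {Cp_space X, baire_space X r \<alpha>} :: ('a \<Rightarrow> real) topology set.
            property_V p q fun_scale E \<and> property_EV p q fun_scale E \<and>
            property_sV p q fun_scale E \<and> property_sEV p q fun_scale E \<and>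
            property_wsV p q fun_scale E \<and> property_wsEV p q fun_scale E) \<and>
         (\<forall>E \<in> {Cp_space X, baire_space X r \<alpha>} :: ('a \<Rightarrow> complex) topology set.
            property_V p q fun_scale E \<and> property_EV p q fun_scale E \<and>
            property_sV p q fun_scale E \<and> property_sEV p q fun_scale E \<and>
            property_wsV p q fun_scale E \<and> property_wsEV p q fun_scale E)"
proof -
  have "1 \<le> q"
    using assms(1,2) by (rule order_trans)
  then show ?thesis
    using assms(3,6,7) by (intro conjI[OF ballI ballI] Cp_and_Baire_properties)
qed

end
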